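(* Let $G$ be a topological group and let a subset $E\subseteq G$ topologically generate $G$. Suppose that for some $f\in C(G)$ and some $m\in\mathbb{N}$, $m\ge 1$, $$\Delta_{h_1}\cdots\Delta_{h_m}f=0\qquad\text{for any } h_1,\dots,h_m\in E.$$ Then $f\in(P_{m-1})$, i.e. $\Delta_{g_1}\cdots\Delta_{g_m}f=0$ for all $g_1,\dots,g_m\in G$.
   Context: $C(G)$ is the space of continuous functions $f:G\to\mathbb{C}$. For $h\in G$, $(\Delta_hf)(x)=f(xh)-f(x)$. $(P_n)$ is the set of $f\in C(G)$ with $\Delta_{h_{n+1}}\cdots\Delta_{h_1}f=0$ for all $h_1,\dots,h_{n+1}\in G$. A subset $E$ topologically generates $G$ if the subgroup generated by $E$ is dense in $G$. *)

theory Defs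
  imports "HOL-Analysis.Analysis" "HOL-Algebra.Generated_Groups"
begin

text \<open>
  The library's class \<open>topological_group_add\<close> is additive and makes the whole type the group.
  Here the group is multiplicative with an explicit carrier. No separation axiom is assumed.
\<close>

locale topological_group = group G for G (structure) +
  fixes T :: "'a topology"
  assumes topspace_eq_carrier: "topspace T = carrier G"
    and continuous_mult: "continuous_map (prod_topology T T) T (\<lambda>(x, y). x \<otimes> y)"
    and continuous_inv: "continuous_map T T (\<lambda>x. inv x)"

definition topologically_generates :: "('a, 'b) monoid_scheme \<Rightarrow> 'a topology \<Rightarrow> 'a set \<Rightarrow> bool"
  where "topologically_generates G T E \<longleftrightarrow>
    E \<subseteq> carrier G \<and> T closure_of (generate G E) = topspace T"

text \<open>
  Elements of \<open>C(G)\<close> are represented by total functions on the underlying type; their values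
  outside the carrier are irrelevant, so two of them are the same element when they agree on
  the carrier, and \<open>f = 0\<close> in \<open>C(G)\<close> is rendered as \<open>f\<close> vanishing on the carrier.
\<close>

definition C_space :: "'a topology \<Rightarrow> ('a \<Rightarrow> complex) set"
  where "C_space T = {f. continuous_map T euclidean f}"

definition diff_op :: "('a, 'b) monoid_scheme \<Rightarrow> 'a \<Rightarrow> ('a \<Rightarrow> complex) \<Rightarrow> 'a \<Rightarrow> complex"
  where "diff_op G h f = (\<lambda>x. f (x \<otimes>\<^bsub>G\<^esub> h) - f x)"

text \<open>The last entry of the list acts first.\<close>

definition diff_ops :: "('a, 'b) monoid_scheme \<Rightarrow> 'a list \<Rightarrow> ('a \<Rightarrow> complex) \<Rightarrow> 'a \<Rightarrow> complex"
  where "diff_ops G hs f = foldr (diff_op G) hs f"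

definition P_class ::
    "('a, 'b) monoid_scheme \<Rightarrow> 'a topology \<Rightarrow> nat \<Rightarrow> ('a \<Rightarrow> complex) set"
  where "P_class G T n = {f \<in> C_space T.
    \<forall>hs. length hs = n + 1 \<and> set hs \<subseteq> carrier G \<longrightarrow>
      (\<forall>x \<in> carrier G. diff_ops G hs f x = 0)}"

end

theory Submission
  imports Defs
begin

text \<open>
  Let \<open>(R\<^sub>g f) x = f (x g)\<close>, so that \<open>\<Delta>\<^sub>g = R\<^sub>g - 1\<close>. Induct on \<open>m\<close>. For \<open>e \<in> E\<close> the induction
  hypothesis applies to \<open>\<Delta>\<^sub>e f\<close>, so every product of \<open>m\<close> difference operators kills \<open>\<Delta>\<^sub>e f\<close>.
  The functions killed by all such products form a space invariant under every \<open>R\<^sub>g\<close>, since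
  \<open>\<Delta>\<^sub>h R\<^sub>g = R\<^sub>g \<Delta>\<^sub>k\<close> with \<open>k = g\<inverse> h g\<close>. From \<open>\<Delta>\<^bsub>gh\<^esub> = R\<^sub>g \<Delta>\<^sub>h + \<Delta>\<^sub>g\<close> it follows that the \<open>g\<close>
  for which \<open>\<Delta>\<^sub>g f\<close> lies in this space form a subgroup; it contains \<open>E\<close> and is closed because
  \<open>f\<close> is continuous, so it is all of \<open>G\<close>.
\<close>

lemma diff_ops_Nil [simp]: "diff_ops G [] f = f"
  by (simp add: diff_ops_def)

lemma diff_ops_Cons [simp]: "diff_ops G (h # hs) f = diff_op G h (diff_ops G hs f)"
  by (simp add: diff_ops_def)

lemma diff_ops_snoc: "diff_ops G (hs @ [h]) f = diff_ops G hs (diff_op G h f)"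
  by (simp add: diff_ops_def)

lemma diff_ops_add:
  "diff_ops G hs (\<lambda>x. u x + v x) = (\<lambda>x. diff_ops G hs u x + diff_ops G hs v x)"
  by (induction hs) (simp_all add: diff_op_def fun_eq_iff)

lemma diff_ops_minus: "diff_ops G hs (\<lambda>x. - u x) = (\<lambda>x. - diff_ops G hs u x)"
  by (induction hs) (simp_all add: diff_op_def fun_eq_iff)

text \<open>Counts operators, so \<open>annihilated G n\<close> corresponds to index n - 1 of
  \<open>P_class\<close>. The case n = 0, vanishing on the carrier, can thus start the induction.
  Continuity is kept separate, leaving a purely algebraic condition.\<close>

definition annihilated :: "('a, 'b) monoid_scheme \<Rightarrow> nat \<Rightarrow> ('a \<Rightarrow> complex) \<Rightarrow> bool"
  where "annihilated G n f \<longleftrightarrow>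
    (\<forall>hs. length hs = n \<longrightarrow> set hs \<subseteq> carrier G \<longrightarrow> (\<forall>x \<in> carrier G. diff_ops G hs f x = 0))"

lemma annihilatedD:
  "annihilated G n f \<Longrightarrow> length hs = n \<Longrightarrow> set hs \<subseteq> carrier G \<Longrightarrow> x \<in> carrier G \<Longrightarrow>
    diff_ops G hs f x = 0"
  by (simp add: annihilated_def)

lemma annihilated_add:
  "annihilated G n u \<Longrightarrow> annihilated G n v \<Longrightarrow> annihilated G n (\<lambda>x. u x + v x)"
  by (simp add: annihilated_def diff_ops_add)

lemma annihilated_minus: "annihilated G n u \<Longrightarrow> annihilated G n (\<lambda>x. - u x)"
  by (simp add: annihilated_def diff_ops_minus)

context group
begin

lemma diff_ops_cong:
  assumes "\<And>y. y \<in> carrier G \<Longrightarrow> u y = v y" and "set hs \<subseteq> carrier G" and "x \<in> carrier G"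
  shows "diff_ops G hs u x = diff_ops G hs v x"
  using assms(2,3) by (induction hs arbitrary: x) (auto simp: assms(1) diff_op_def)

lemma annihilated_cong:
  assumes "\<And>y. y \<in> carrier G \<Longrightarrow> u y = v y"
  shows "annihilated G n u \<longleftrightarrow> annihilated G n v"
  unfolding annihilated_def using diff_ops_cong[of u v, OF assms] by simp

lemma diff_ops_translate:
  assumes "g \<in> carrier G" and "set hs \<subseteq> carrier G" and "x \<in> carrier G"
  shows "diff_ops G hs (\<lambda>y. u (y \<otimes> g)) x = diff_ops G (map (\<lambda>h. inv g \<otimes> h \<otimes> g) hs) u (x \<otimes> g)"
  using assms(2,3)
proof (induction hs arbitrary: x)
  case (Cons h hs)
  then have h: "h \<in> carrier G" "set hs \<subseteq> carrier G" "x \<in> carrier G" by auto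
  have "x \<otimes> g \<otimes> (inv g \<otimes> h \<otimes> g) = x \<otimes> h \<otimes> g"
    using h assms(1) by (metis inv_closed inv_solve_left m_assoc m_closed)
  then show ?case
    using h assms(1) Cons.IH by (simp add: diff_op_def)
qed simp

text \<open>Conjugation by g preserves the length of a list and keeps its entries in the carrier.
  This is why \<open>annihilated\<close> ranges over all of G: conjugates of elements of E may leave
  E.\<close>

lemma annihilated_translate:
  assumes "annihilated G n u" and "g \<in> carrier G"
  shows "annihilated G n (\<lambda>y. u (y \<otimes> g))"
  unfolding annihilated_def
proof (intro allI impI ballI)
  fix hs x
  assume hs: "length hs = n" "set hs \<subseteq> carrier G" and x: "x \<in> carrier G"
  have "set (map (\<lambda>h. inv g \<otimes> h \<otimes> g) hs) \<subseteq> carrier G"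
    using hs(2) assms(2) by auto
  then show "diff_ops G hs (\<lambda>y. u (y \<otimes> g)) x = 0"
    using annihilatedD[OF assms(1)] hs x assms(2) by (simp add: diff_ops_translate)
qed

lemma annihilated_diff_op_generate:
  assumes "E \<subseteq> carrier G" and "\<And>e. e \<in> E \<Longrightarrow> annihilated G n (diff_op G e f)"
    and "g \<in> generate G E"
  shows "annihilated G n (diff_op G g f)"
  using assms(3)
proof (induction rule: generate.induct)
  case one
  have "annihilated G n (\<lambda>x. 0)"
  proof -
    have "diff_ops G hs (\<lambda>x. 0) = (\<lambda>x. 0)" for hs
      by (induction hs) (simp_all add: diff_op_def)
    then show ?thesis by (simp add: annihilated_def)
  qed
  then show ?case
    using annihilated_cong[of "diff_op G \<one> f" "\<lambda>x. 0"] by (simp add: diff_op_def)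
next
  case (incl e)
  then show ?case by (rule assms(2))
next
  case (inv e)
  then have e: "e \<in> carrier G" using assms(1) by auto
  \<comment> \<open>The difference along the inverse of e is minus the difference along e, taken
    from the translated base point.\<close>
  have "annihilated G n (\<lambda>x. - diff_op G e f (x \<otimes> inv e))"
    using inv e by (intro annihilated_minus annihilated_translate assms(2) inv_closed)
  moreover have "- diff_op G e f (x \<otimes> inv e) = diff_op G (inv e) f x" if "x \<in> carrier G" for x
    using that e by (simp add: diff_op_def m_assoc)
  ultimately show ?case by (rule annihilated_cong[THEN iffD1, rotated])
next
  case (eng g h)
  then have gh: "g \<in> carrier G" "h \<in> carrier G"
    using assms(1) generate_in_carrier by auto
  \<comment> \<open>The increment from x to x g h is split at the intermediate point x g.\<close>
  have "annihilated G n (\<lambda>x. diff_op G h f (x \<otimes> g) + diff_op G g f x)"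
    using eng gh by (intro annihilated_add annihilated_translate)
  moreover have "diff_op G h f (x \<otimes> g) + diff_op G g f x = diff_op G (g \<otimes> h) f x"
    if "x \<in> carrier G" for x
    using that gh by (simp add: diff_op_def m_assoc)
  ultimately show ?case by (rule annihilated_cong[THEN iffD1, rotated])
qed

end

text \<open>With \<open>hs\<close> and \<open>x\<close> fixed, the value is a finite signed sum of
  terms \<open>F s y\<close> with y in the carrier, so continuity in the parameter s at each such y
  suffices.\<close>

lemma (in monoid) continuous_map_diff_ops_family:
  assumes "\<And>y. y \<in> carrier G \<Longrightarrow> continuous_map X euclidean (\<lambda>s. F s y)"
    and "set hs \<subseteq> carrier G" and "x \<in> carrier G"
  shows "continuous_map X euclidean (\<lambda>s. diff_ops G hs (F s) x)"
  using assms(2,3)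
  by (induction hs arbitrary: x) (auto simp: assms(1) diff_op_def intro!: continuous_map_diff)

context topological_group
begin

lemma continuous_map_mult_right:
  assumes "h \<in> carrier G"
  shows "continuous_map T T (\<lambda>x. x \<otimes> h)"
proof -
  have "continuous_map T (prod_topology T T) (\<lambda>x. (x, h))"
    using assms by (simp add: continuous_map_pairwise comp_def topspace_eq_carrier)
  from continuous_map_compose[OF this continuous_mult] show ?thesis by (simp add: comp_def)
qed

lemma continuous_map_mult_left:
  assumes "h \<in> carrier G"
  shows "continuous_map T T (\<lambda>x. h \<otimes> x)"
proof -
  have "continuous_map T (prod_topology T T) (\<lambda>x. (h, x))"
    using assms by (simp add: continuous_map_pairwise comp_def topspace_eq_carrier)
  from continuous_map_compose[OF this continuous_mult] show ?thesis by (simp add: comp_def)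
qed

lemma diff_op_C_space:
  assumes "f \<in> C_space T" and "h \<in> carrier G"
  shows "diff_op G h f \<in> C_space T"
proof -
  have f: "continuous_map T euclidean f" using assms(1) by (simp add: C_space_def)
  have "continuous_map T euclidean (\<lambda>x. f (x \<otimes> h))"
    using continuous_map_compose[OF continuous_map_mult_right[OF assms(2)] f] by (simp add: comp_def)
  then show ?thesis
    using f by (simp add: C_space_def diff_op_def continuous_map_diff)
qed

text \<open>For each fixed \<open>hs\<close> and \<open>x\<close>, the condition on s is the
  vanishing of a continuous function of s, hence closed.\<close>

lemma annihilated_diff_op_closure:
  assumes "f \<in> C_space T" and "\<And>s. s \<in> S \<Longrightarrow> annihilated G n (diff_op G s f)"
    and "S \<subseteq> carrier G" and "g \<in> T closure_of S"
  shows "annihilated G n (diff_op G g f)"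
  unfolding annihilated_def
proof (intro allI impI ballI)
  fix hs x
  assume hs: "length hs = n" "set hs \<subseteq> carrier G" and x: "x \<in> carrier G"
  let ?\<phi> = "\<lambda>s. diff_ops G hs (diff_op G s f) x"
  have f: "continuous_map T euclidean f" using assms(1) by (simp add: C_space_def)
  have "continuous_map T euclidean (\<lambda>s. diff_op G s f y)" if "y \<in> carrier G" for y
    using continuous_map_compose[OF continuous_map_mult_left[OF that] f]
    by (simp add: diff_op_def comp_def continuous_map_diff)
  then have "continuous_map T euclidean ?\<phi>"
    using hs(2) x by (rule continuous_map_diff_ops_family)
  then have "closedin T {s \<in> topspace T. ?\<phi> s \<in> {0}}"
    by (rule closedin_continuous_map_preimage) simp
  moreover have "S \<subseteq> {s \<in> topspace T. ?\<phi> s \<in> {0}}"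
    using assms(2,3) hs x annihilatedD by (fastforce simp: topspace_eq_carrier)
  ultimately have "T closure_of S \<subseteq> {s \<in> topspace T. ?\<phi> s \<in> {0}}"
    by (rule closure_of_minimal[rotated])
  then show "?\<phi> g = 0" using assms(4) by auto
qed

lemma annihilated_if_generators:
  assumes "topologically_generates G T E" and "f \<in> C_space T"
    and "\<And>hs x. length hs = m \<Longrightarrow> set hs \<subseteq> E \<Longrightarrow> x \<in> carrier G \<Longrightarrow> diff_ops G hs f x = 0"
  shows "annihilated G m f"
  using assms(2,3)
proof (induction m arbitrary: f)
  case 0
  then show ?case by (simp add: annihilated_def)
next
  case (Suc m)
  have E: "E \<subseteq> carrier G" and dense: "T closure_of generate G E = carrier G"
    using assms(1) by (auto simp: topologically_generates_def topspace_eq_carrier)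
  have "annihilated G m (diff_op G e f)" if "e \<in> E" for e
  proof (rule Suc.IH)
    show "diff_op G e f \<in> C_space T" using Suc.prems(1) E that by (auto intro: diff_op_C_space)
    show "diff_ops G hs (diff_op G e f) x = 0"
      if "length hs = m" "set hs \<subseteq> E" "x \<in> carrier G" for hs x
      \<comment> \<open>The last entry acts first, so e goes at the end of the list.\<close>
      using Suc.prems(2)[of "hs @ [e]" x] that \<open>e \<in> E\<close> by (simp add: diff_ops_snoc)
  qed
  then have "annihilated G m (diff_op G g f)" if "g \<in> generate G E" for g
    using annihilated_diff_op_generate[OF E] that by blast
  then have *: "annihilated G m (diff_op G g f)" if "g \<in> carrier G" for g
    using annihilated_diff_op_closure[OF Suc.prems(1) _ generate_incl[OF E]] dense that by simp
  show ?case
    unfolding annihilated_def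
  proof (intro allI impI ballI)
    fix hs x
    assume hs: "length hs = Suc m" "set hs \<subseteq> carrier G" and x: "x \<in> carrier G"
    \<comment> \<open>The operator acting first is \<open>diff_op G g\<close>; the m entries of
      \<open>ks\<close> then kill the result by \<open>*\<close>.\<close>
    then obtain ks g where "hs = ks @ [g]" by (metis length_Suc_conv_rev)
    then show "diff_ops G hs f x = 0"
      using annihilatedD[OF *] hs x by (simp add: diff_ops_snoc)
  qed
qed

end

theorem theorem4p1:
  fixes G :: "('a, 'b) monoid_scheme"
    and T :: "'a topology"
    and E :: "'a set"
    and f :: "'a \<Rightarrow> complex"
    and m :: nat
  assumes "topological_group G T"
    and "E \<subseteq> carrier G"
    and "topologically_generates G T E"
    and "f \<in> C_space T"
    and "m \<ge> 1"
    and "\<And>hs. length hs = m \<Longrightarrow> set hs \<subseteq> E \<Longrightarrow>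
           \<forall>x \<in> carrier G. diff_ops G hs f x = 0"
  shows "f \<in> P_class G T (m - 1)"
proof -
  interpret topological_group G T by (rule assms(1))
  have "annihilated G m f"
    using assms(6) by (intro annihilated_if_generators[OF assms(3,4)]) simp
  \<comment> \<open>Since m is at least 1, truncated subtraction gives m - 1 + 1 = m, the list
    length required by \<open>P_class\<close>.\<close>
  then show ?thesis
    using assms(4,5) by (simp add: P_class_def annihilated_def)
qed

end
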